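(* Let $f\colon \mathbb{H}\to\mathbb{H}$ be a parabolic holomorphic map with its Denjoy-Wolff point at infinity, and let $\beta\in\mathbb{R}$ and $\mu$ (a positive finite Borel measure on $\mathbb{R}$) be its representing parameters, that is, $$f(z) = z + \beta + \int_{\mathbb{R}}\frac{1+tz}{t-z}\,d\mu(t), \quad z\in\mathbb{H}.$$ If $f$ is of finite shift, then $\int_{\mathbb{R}}|t|\,d\mu(t)<+\infty$. Moreover, $f$ is of finite shift if and only if one of the following holds: (i) $\int_{(-\infty,0)}|t|\,d\mu(t)<+\infty$, $\int_{(0,+\infty)}t^2\,d\mu(t)<+\infty$, and $\beta>\int_{\mathbb{R}}t\,d\mu(t)$. (ii) $\int_{(-\infty,0)}t^2\,d\mu(t)<+\infty$, $\int_{(0,+\infty)}|t|\,d\mu(t)<+\infty$, and $\beta<\int_{\mathbb{R}}t\,d\mu(t)$.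
   Context: $\mathbb{H}=\{z=x+iy\in\mathbb{C}: y>0\}$ is the upper half-plane, and $f^n$ denotes the $n$-th iterate of $f$ ($f^0=\mathrm{Id}$, $f^{n+1}=f\circ f^n$). A holomorphic map $f\colon\mathbb{H}\to\mathbb{H}$ is non-elliptic if it has no fixed point in $\mathbb{H}$; then $f^n$ converges, uniformly on compact subsets of $\mathbb{H}$, to a point $\tau\in\mathbb{R}\cup\{\infty\}$, called the Denjoy-Wolff point of $f$. If $f$ is non-elliptic with Denjoy-Wolff point $\infty$, the angular (non-tangential) limit $\lambda=\angle\lim_{z\to\infty} f(z)/z$ exists and lies in $[1,+\infty)$; $f$ is called parabolic if $\lambda=1$. Representation (known): a holomorphic $f\colon\mathbb{H}\to\mathbb{H}$ is parabolic with Denjoy-Wolff point at infinity if and only if it can be written as $f(z)=z+\beta+\int_{\mathbb{R}}\frac{1+tz}{t-z}\,d\mu(t)$, $z\in\mathbb{H}$, with $\beta\in\mathbb{R}$ and $\mu$ a positive finite Borel measure on $\mathbb{R}$, not both null; the pair $(\beta,\mu)$ is unique. A parabolic $f\colon\mathbb{H}\to\mathbb{H}$ with Denjoy-Wolff point at infinity is of finite shift if there exists $z_0\in\mathbb{H}$ such that the orbit $z_n=x_n+iy_n=f^n(z_0)$ satisfies $\sup_n y_n<+\infty$ (this does not depend on the choice of $z_0$). *)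

theory Defs
  imports "HOL-Analysis.Analysis"
begin

definition upper_half_plane :: "complex set" where
  "upper_half_plane = {z. 0 < Im z}"

definition non_elliptic :: "(complex \<Rightarrow> complex) \<Rightarrow> bool" where
  "non_elliptic f \<longleftrightarrow>
     f holomorphic_on upper_half_plane \<and>
     f \<in> upper_half_plane \<rightarrow> upper_half_plane \<and>
     (\<forall>z\<in>upper_half_plane. f z \<noteq> z)"

(* The iterates tend to infinity uniformly on compact subsets of the half-plane. *)
definition denjoy_wolff_infinity :: "(complex \<Rightarrow> complex) \<Rightarrow> bool" where
  "denjoy_wolff_infinity f \<longleftrightarrow>
     (\<forall>K. compact K \<and> K \<subseteq> upper_half_plane \<longrightarrow>
        (\<forall>R::real. \<forall>\<^sub>F n in sequentially. \<forall>z\<in>K. R < norm ((f ^^ n) z)))"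

(* Non-tangential approach to infinity: z tends to infinity inside a sector
   |Re z| <= M Im z, for every aperture M. *)
definition angular_limit_infinity :: "(complex \<Rightarrow> complex) \<Rightarrow> complex \<Rightarrow> bool" where
  "angular_limit_infinity g l \<longleftrightarrow>
     (\<forall>M>0. (g \<longlongrightarrow> l)
        (inf at_infinity (principal {z \<in> upper_half_plane. \<bar>Re z\<bar> \<le> M * Im z})))"

definition parabolic_infinity :: "(complex \<Rightarrow> complex) \<Rightarrow> bool" where
  "parabolic_infinity f \<longleftrightarrow>
     non_elliptic f \<and> denjoy_wolff_infinity f \<and> angular_limit_infinity (\<lambda>z. f z / z) 1"

(* Only meant for f satisfying parabolic_infinity. *)
definition finite_shift :: "(complex \<Rightarrow> complex) \<Rightarrow> bool" where
  "finite_shift f \<longleftrightarrow>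
     (\<exists>z\<^sub>0\<in>upper_half_plane. bdd_above (range (\<lambda>n. Im ((f ^^ n) z\<^sub>0))))"

(* The integrand is bounded and continuous in t for each z in the half-plane, so the
   Bochner integral is a genuine one. *)
definition representing_parameters ::
    "(complex \<Rightarrow> complex) \<Rightarrow> real \<Rightarrow> real measure \<Rightarrow> bool" where
  "representing_parameters f \<beta> \<mu> \<longleftrightarrow>
     finite_measure \<mu> \<and> sets \<mu> = sets borel \<and>
     (\<beta> \<noteq> 0 \<or> emeasure \<mu> UNIV \<noteq> 0) \<and>
     (\<forall>z\<in>upper_half_plane.
        f z = z + of_real \<beta> + (LINT t|\<mu>. (1 + of_real t * z) / (of_real t - z)))"

end

theory Submission
  imports Defs
begin

text \<open>
  Put $k_z(t) = (1+t^2)/|t-z|^2$ and $I(z) = \int k_z\,d\mu$. Two identities for the integrand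
  $(1+tz)/(t-z) = (1+t^2)/(t-z) - t$ drive the whole proof. Its imaginary part is $\mathrm{Im}\,z$ times
  $k_z(t)$, so $\mathrm{Im}\,f(z) = \mathrm{Im}\,z\,(1+I(z))$: along an orbit $z_n = x_n + iy_n$ the heights
  increase by the factors $1+I(z_n)$, and the shift is finite exactly when $\sum_n I(z_n)$
  converges. Its difference quotient is $(1+t^2)/((t-z)(t-w))$, whose modulus is at most
  $(k_z+k_w)/2$, so $f(w)-f(z) = (w-z)(1+J)$ with $|J| \le (I(z)+I(w))/2$.

  Suppose the heights are bounded. By the second identity the increments $d_n = z_{n+1}-z_n$
  satisfy $d_{n+1} = d_n(1+J_n)$ with $\sum|J_n| < \infty$. Hence they converge, and their limit is not
  zero because an absolutely convergent product with non-zero factors is not zero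
  (lemma \<open>increments_limit\<close>). Since $\mathrm{Im}\,d_n \to 0$, the limit is a real number $l \ne 0$, and
  the orbit runs off to the right or to the left with asymptotically constant speed. The
  function $\sum_n k_{z_n}(t)$ is $\mu$-integrable, and bounds for it from below give the moment
  conditions. About $|t|$ of the points $z_n$ lie within a multiple of $1+|t|$ from $t$, and
  each contributes at least a constant, so the sum is at least a multiple of $|t|$
  (\<open>abs_le_accumulated\<close>); if $l > 0$, every $t > 0$ has a point of the orbit at bounded distance,
  so the sum is at least a multiple of $t^2$ there (\<open>square_le_accumulated\<close>). These moments make
  dominated convergence applicable to $f(z)-z = \beta - \int t\,d\mu + \int (1+t^2)/(t-z)\,d\mu$, so that
  $d_n \to \beta - \int t\,d\mu$; this limit is $l > 0$.

  Conversely, under condition (i) the same dominated convergence shows that $\mathrm{Re}(f(z)-z)$ stays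
  at or above some $d > 0$ on a quadrant $\mathrm{Re}\,z \ge X$, $\mathrm{Im}\,z \ge 1$. An orbit starting there has real
  parts separated by $d$, and a telescoping estimate (\<open>separated_sum\<close>) bounds $\sum_n k_{z_n}(t)$ by a
  multiple of $1+|t|$ for $t < 0$ and of $1+t^2$ for $t \ge 0$. Integration bounds $\sum_n I(z_n)$ and
  with it the heights (\<open>bounded_orbit_if_right_conditions\<close>).

  Condition (ii) is condition (i) for the map conjugated by the reflection $z \mapsto -\bar z$, which
  replaces $\beta$ by $-\beta$ and $\mu$ by its image under $t \mapsto -t$.
\<close>

section \<open>Kernels and pointwise bounds\<close>

text \<open>
  Integrability of this single function expresses both moment conditions of case (i), and the same
  function dominates the integrand on the right quadrant.
\<close>
definition right_weight :: "real \<Rightarrow> real" where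
  "right_weight t = (if t < 0 then \<bar>t\<bar> else t\<^sup>2)"

text \<open>
  Up to the factor $\pi/\mathrm{Im}\,z$, the Poisson kernel of the half-plane at $z$, weighted by $1+t^2$.
\<close>
definition dilation_kernel :: "complex \<Rightarrow> real \<Rightarrow> real" where
  "dilation_kernel z t = (1 + t\<^sup>2) / (cmod (of_real t - z))\<^sup>2"

lemma right_weight_nonneg: "0 \<le> right_weight t"
  by (simp add: right_weight_def)

lemma dilation_kernel_nonneg: "0 \<le> dilation_kernel z t"
  by (simp add: dilation_kernel_def)

lemma Im_le_dist_real: "\<bar>Im z\<bar> \<le> cmod (of_real t - z)"
  using abs_Im_le_cmod[of "of_real t - z"] by simp

lemma of_real_neq_upper: "0 < Im z \<Longrightarrow> of_real t - z \<noteq> 0"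
  by (auto simp: complex_eq_iff)

lemma nevanlinna_integrand_eq:
  assumes "0 < Im z"
  shows "(1 + of_real t * z) / (of_real t - z) = (1 + (of_real t)\<^sup>2) / (of_real t - z) - of_real t"
  using of_real_neq_upper[OF assms, of t] by (simp add: field_simps power2_eq_square)

lemma Im_nevanlinna_integrand:
  assumes "0 < Im z"
  shows "Im ((1 + of_real t * z) / (of_real t - z)) = Im z * dilation_kernel z t"
proof -
  have "Im ((1 + (of_real t)\<^sup>2) / (of_real t - z)) = Im (of_real (1 + t\<^sup>2) / (of_real t - z))"
    by simp
  also have "\<dots> = Im z * dilation_kernel z t"
    by (simp add: Im_divide dilation_kernel_def cmod_power2 del: of_real_add of_real_power)
  finally show ?thesis
    by (simp add: nevanlinna_integrand_eq[OF assms])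
qed

text \<open>
  Dividing with remainder by $t - z$ leaves a numerator that does not involve $t$, so the
  integrand is bounded in $t$.
\<close>
lemma nevanlinna_integrand_bound:
  assumes "0 < Im z"
  shows "cmod ((1 + of_real t * z) / (of_real t - z)) \<le> cmod (1 + z\<^sup>2) / Im z + cmod z"
proof -
  have "(1 + of_real t * z) / (of_real t - z) = (1 + z\<^sup>2) / (of_real t - z) + z"
    using of_real_neq_upper[OF assms, of t] by (simp add: field_simps power2_eq_square)
  moreover have "cmod ((1 + z\<^sup>2) / (of_real t - z)) \<le> cmod (1 + z\<^sup>2) / Im z"
    unfolding norm_divide using Im_le_dist_real[of z t] assms
    by (intro divide_left_mono mult_pos_pos) auto
  ultimately show ?thesis
    by (metis add.commute add_left_mono norm_triangle_le)
qed

lemma nevanlinna_integrand_diff: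
  assumes "0 < Im z" "0 < Im w"
  shows "(1 + of_real t * w) / (of_real t - w) - (1 + of_real t * z) / (of_real t - z)
    = (w - z) * (of_real (1 + t\<^sup>2) / ((of_real t - z) * (of_real t - w)))"
  using of_real_neq_upper[OF assms(1), of t] of_real_neq_upper[OF assms(2), of t]
    by (simp add: diff_frac_eq) (simp add: algebra_simps power2_eq_square)

text \<open>
  The inequality between the arithmetic and the geometric mean of the two reciprocal distances.
  A bound by a sum, in place of the product that the Cauchy-Schwarz inequality would give, is
  enough for summability along an orbit.
\<close>
lemma mixed_kernel_bound:
  assumes "0 < Im z" "0 < Im w"
  shows "cmod (of_real (1 + t\<^sup>2) / ((of_real t - z) * (of_real t - w)))
    \<le> (dilation_kernel z t + dilation_kernel w t) / 2"
proof -
  define a b where "a = inverse (cmod (of_real t - z))" and "b = inverse (cmod (of_real t - w))"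
  have "0 \<le> (a - b)\<^sup>2" by simp
  then have "a * b \<le> (a\<^sup>2 + b\<^sup>2) / 2" by (simp add: power2_eq_square algebra_simps)
  then have "(1 + t\<^sup>2) * (a * b) \<le> (1 + t\<^sup>2) * ((a\<^sup>2 + b\<^sup>2) / 2)"
    by (intro mult_left_mono) auto
  moreover have "cmod (of_real (1 + t\<^sup>2) / ((of_real t - z) * (of_real t - w)))
    = (1 + t\<^sup>2) * (a * b)"
    unfolding norm_divide norm_mult norm_of_real a_def b_def by (simp add: divide_inverse)
  moreover have "dilation_kernel z t = (1 + t\<^sup>2) * a\<^sup>2" "dilation_kernel w t = (1 + t\<^sup>2) * b\<^sup>2"
    by (simp_all only: dilation_kernel_def a_def b_def divide_inverse power_inverse)
  ultimately show ?thesis by (simp only: distrib_left times_divide_eq_right)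
qed

text \<open>
  A dominating function that is uniform in the part of the right quadrant above height $y$. For $t < 0$
  the distance to $z$ is at least $|t|$, which saves one power of $t$; for $t \ge 0$ only the height is
  available, and the full $t^2$ remains.
\<close>
lemma shifted_integrand_bound:
  assumes "0 \<le> Re z" "0 < y" "y \<le> Im z"
  shows "cmod (of_real (1 + t\<^sup>2) / (of_real t - z)) \<le> (1 + 1 / y) * (1 + right_weight t)"
proof -
  define r where "r = cmod (of_real t - z)"
  have r: "y \<le> r" using Im_le_dist_real[of z t] assms by (simp add: r_def)
  have "\<bar>t - Re z\<bar> \<le> r" using abs_Re_le_cmod[of "of_real t - z"] by (simp add: r_def)
  have rpos: "0 < r" using r assms by simp
  have inv: "1 / r \<le> 1 / y" using r assms by (simp add: frac_le)
  have "(1 + t\<^sup>2) / r \<le> (1 + 1 / y) * (1 + right_weight t)"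
  proof (cases "t < 0")
    case True
    then have "\<bar>t\<bar> \<le> r" using \<open>\<bar>t - Re z\<bar> \<le> r\<close> assms by simp
    then have "t\<^sup>2 \<le> \<bar>t\<bar> * r" using mult_left_mono[of "\<bar>t\<bar>" r "\<bar>t\<bar>"] by (simp add: power2_eq_square)
    then have "t\<^sup>2 / r \<le> \<bar>t\<bar>" using rpos by (simp add: field_simps)
    then have "(1 + t\<^sup>2) / r \<le> 1 / y + \<bar>t\<bar>" using inv by (simp add: add_divide_distrib)
    also have "\<dots> \<le> (1 + 1 / y) * (1 + \<bar>t\<bar>)" using assms by (simp add: field_simps)
    finally show ?thesis using True by (simp add: right_weight_def)
  next
    case False
    have "(1 + t\<^sup>2) * (1 / r) \<le> (1 + t\<^sup>2) * (1 + 1 / y)"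
      using inv by (intro mult_left_mono) auto
    then show ?thesis using False by (simp add: right_weight_def mult.commute)
  qed
  then show ?thesis
    by (simp add: r_def norm_divide norm_of_real del: of_real_add of_real_power)
qed

lemma right_weight_ge_abs: "\<bar>t\<bar> \<le> 1 + right_weight t"
proof -
  have "\<bar>t\<bar> \<le> 1 + t\<^sup>2"
    using sum_squares_bound[of "\<bar>t\<bar>" 1] by (simp add: power2_eq_square)
  then show ?thesis by (cases "0 \<le> t") (simp_all add: right_weight_def)
qed

lemma dilation_kernel_lower:
  assumes "0 < Im z" "cmod (of_real t - z) \<le> R"
  shows "1 + t\<^sup>2 \<le> R\<^sup>2 * dilation_kernel z t"
proof -
  have "0 < cmod (of_real t - z)" using of_real_neq_upper[OF assms(1)] by simp
  then show ?thesis
    using power_mono[OF assms(2), of 2] mult_right_mono[of "(cmod (of_real t - z))\<^sup>2" "R\<^sup>2" "1 + t\<^sup>2"]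
    by (simp add: dilation_kernel_def pos_le_divide_eq mult.commute)
qed

lemma dilation_kernel_upper:
  assumes "1 \<le> Im z"
  shows "dilation_kernel z t \<le> (1 + t\<^sup>2) * (1 / (1 + (Re z - t)\<^sup>2))"
proof -
  have "(Re z - t)\<^sup>2 + 1 \<le> (cmod (of_real t - z))\<^sup>2"
    using one_le_power[OF assms, of 2] by (simp add: cmod_power2 power2_commute)
  then have "(1 + t\<^sup>2) / (cmod (of_real t - z))\<^sup>2 \<le> (1 + t\<^sup>2) / (1 + (Re z - t)\<^sup>2)"
    by (intro divide_left_mono mult_pos_pos) (auto simp: add_pos_nonneg intro: less_le_trans)
  then show ?thesis by (simp add: dilation_kernel_def)
qed

section \<open>Sequences with separated terms\<close>

text \<open>
  The bounded increasing function $x/(1+|x|)$ is a potential for the following sum: a step of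
  length at least $d$ starting at $a$ raises it by at least a multiple, depending on $d$, of $1/(1+a^2)$,
  whichever side of $0$ the step starts or ends on.
\<close>
lemma separated_step:
  fixes a b d :: real
  assumes "0 < d" "a + d \<le> b"
  shows "d / ((1 + \<bar>a\<bar>) * (1 + d + \<bar>a\<bar>)) \<le> b / (1 + \<bar>b\<bar>) - a / (1 + \<bar>a\<bar>)"
proof -
  define c where "c = a + d"
  \<comment> \<open>By monotonicity of the potential it suffices to treat the shortest step, which ends at $a + d$.\<close>
  have mono: "c / (1 + \<bar>c\<bar>) \<le> b / (1 + \<bar>b\<bar>)"
  proof (cases "0 \<le> c")
    case True
    then show ?thesis using assms by (simp add: c_def field_simps)
  next
    case False
    then have c: "c < 0" by simp
    show ?thesis
    proof (cases "0 \<le> b")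
      case True
      then have "0 \<le> b / (1 + \<bar>b\<bar>)" by simp
      moreover have "c / (1 + \<bar>c\<bar>) \<le> 0" using c by (simp add: divide_nonpos_pos)
      ultimately show ?thesis by linarith
    next
      case False
      then show ?thesis using c assms by (simp add: c_def field_simps)
    qed
  qed
  have num: "d \<le> c * (1 + \<bar>a\<bar>) - a * (1 + \<bar>c\<bar>)"
  proof -
    have "a * \<bar>c\<bar> \<le> c * \<bar>a\<bar>"
    proof (cases "0 \<le> a")
      case True
      then show ?thesis using assms by (simp add: c_def)
    next
      case False
      then have "c * \<bar>a\<bar> - a * \<bar>c\<bar> = (- a) * (c + \<bar>c\<bar>)" by (simp add: algebra_simps)
      also have "\<dots> \<ge> 0" using False by (intro mult_nonneg_nonneg) auto
      finally show ?thesis by simp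
    qed
    then show ?thesis by (simp add: c_def algebra_simps)
  qed
  have "d / ((1 + \<bar>a\<bar>) * (1 + d + \<bar>a\<bar>)) \<le> (c * (1 + \<bar>a\<bar>) - a * (1 + \<bar>c\<bar>)) / ((1 + \<bar>a\<bar>) * (1 + \<bar>c\<bar>))"
  proof (rule frac_le)
    show "d \<le> c * (1 + \<bar>a\<bar>) - a * (1 + \<bar>c\<bar>)" by (rule num)
    show "0 \<le> c * (1 + \<bar>a\<bar>) - a * (1 + \<bar>c\<bar>)" using num assms by linarith
    show "0 < (1 + \<bar>a\<bar>) * (1 + \<bar>c\<bar>)" by (intro mult_pos_pos) auto
    show "(1 + \<bar>a\<bar>) * (1 + \<bar>c\<bar>) \<le> (1 + \<bar>a\<bar>) * (1 + d + \<bar>a\<bar>)"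
      using assms by (intro mult_left_mono) (auto simp: c_def)
  qed
  also have "\<dots> = c / (1 + \<bar>c\<bar>) - a / (1 + \<bar>a\<bar>)"
    by (subst diff_frac_eq) (auto simp: mult.commute)
  finally show ?thesis using mono by linarith
qed

text \<open>
  The sum telescopes against the potential. Keeping the initial value on the right-hand side
  matters: for $a_0 \ge 0$ the bound decays like $1/(1+a_0)$, and otherwise it is still bounded.
\<close>
lemma separated_sum:
  fixes a :: "nat \<Rightarrow> real"
  assumes d: "0 < d" and sep: "\<And>n. a n + d \<le> a (Suc n)"
  shows "(\<Sum>n<m. 1 / (1 + (a n)\<^sup>2)) \<le> 2 * (1 + d) / d * (1 - a 0 / (1 + \<bar>a 0\<bar>))"
proof -
  define h where "h x = x / (1 + \<bar>x\<bar>)" for x :: real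
  have increment: "1 / (1 + (a n)\<^sup>2) \<le> 2 * (1 + d) / d * (h (a (Suc n)) - h (a n))" for n
  proof -
    define u where "u = \<bar>a n\<bar>"
    have "2 * u \<le> 1 + u\<^sup>2" using sum_squares_bound[of u 1] by simp
    then have u2: "(1 + u)\<^sup>2 \<le> 2 * (1 + (a n)\<^sup>2)" by (simp add: u_def power2_eq_square algebra_simps)
    have "(1 + u) * (1 + d + u) \<le> (1 + d) * (1 + u)\<^sup>2"
      using d by (simp add: u_def power2_eq_square algebra_simps)
    also have "\<dots> \<le> (1 + d) * (2 * (1 + (a n)\<^sup>2))"
      using u2 d by (intro mult_left_mono) auto
    finally have le: "(1 + u) * (1 + d + u) \<le> 2 * (1 + d) * (1 + (a n)\<^sup>2)"
      by (simp only: ac_simps)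
    have "0 < (1 + u) * (1 + d + u)" using d by (simp add: u_def)
    moreover have "0 < 1 + (a n)\<^sup>2" by (simp add: add_pos_nonneg)
    ultimately have "1 / (1 + (a n)\<^sup>2) \<le> 2 * (1 + d) * (1 / ((1 + u) * (1 + d + u)))"
      using le by (simp add: divide_simps mult.commute)
    also have "\<dots> = 2 * (1 + d) / d * (d / ((1 + u) * (1 + d + u)))"
      using d by simp
    also have "\<dots> \<le> 2 * (1 + d) / d * (h (a (Suc n)) - h (a n))"
      using separated_step[OF d sep, of n] d unfolding h_def u_def by (intro mult_left_mono) auto
    finally show ?thesis .
  qed
  have "(\<Sum>n<m. 1 / (1 + (a n)\<^sup>2)) \<le> (\<Sum>n<m. 2 * (1 + d) / d * (h (a (Suc n)) - h (a n)))"
    by (intro sum_mono increment)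
  also have "\<dots> = 2 * (1 + d) / d * (h (a m) - h (a 0))"
    unfolding sum_distrib_left[symmetric] by (simp only: sum_lessThan_telescope[of "\<lambda>n. h (a n)"])
  also have "\<dots> \<le> 2 * (1 + d) / d * (1 - h (a 0))"
  proof -
    have "h (a m) \<le> 1" by (simp add: h_def)
    then show ?thesis using d by (intro mult_left_mono) auto
  qed
  finally show ?thesis by (simp add: h_def)
qed

lemma at_top_if_increments_tendsto_pos:
  fixes x :: "nat \<Rightarrow> real"
  assumes "(\<lambda>n. x (Suc n) - x n) \<longlonglongrightarrow> l" "0 < l"
  shows "filterlim x at_top sequentially"
proof -
  obtain N where N: "\<And>n. n \<ge> N \<Longrightarrow> l / 2 < x (Suc n) - x n"
    using order_tendstoD(1)[OF assms(1), of "l / 2"] assms(2) by (auto simp: eventually_sequentially)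
  have "(x N - real N * (l / 2)) + real n * (l / 2) \<le> x n" if "N \<le> n" for n
    using that
  proof (induction n rule: dec_induct)
    case (step n)
    then show ?case using N[of n] by (simp add: algebra_simps add_divide_distrib)
  qed simp
  then have "\<forall>\<^sub>F n in sequentially. (x N - real N * (l / 2)) + real n * (l / 2) \<le> x n"
    by (auto simp: eventually_sequentially)
  moreover have "filterlim (\<lambda>n. (x N - real N * (l / 2)) + real n * (l / 2)) at_top sequentially"
    using assms(2)
    by (intro filterlim_tendsto_add_at_top[OF tendsto_const]
        filterlim_at_top_mult_tendsto_pos[OF tendsto_const _ filterlim_real_sequentially]) simp
  ultimately show ?thesis by (rule filterlim_at_top_mono[rotated])
qed

section \<open>Maps with a Nevanlinna representation\<close>

locale nevanlinna_map =
  fixes f :: "complex \<Rightarrow> complex" and \<beta> :: real and \<mu> :: "real measure"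
  assumes rep: "representing_parameters f \<beta> \<mu>"
begin

sublocale finite_measure \<mu>
  using rep by (simp add: representing_parameters_def)

lemma sets_mu [measurable_cong]: "sets \<mu> = sets borel"
  using rep by (simp add: representing_parameters_def)

lemma space_mu: "space \<mu> = UNIV"
  using sets_eq_imp_space_eq[OF sets_mu] by simp

lemma f_eq:
  "0 < Im z \<Longrightarrow> f z = z + of_real \<beta> + (LINT t|\<mu>. (1 + of_real t * z) / (of_real t - z))"
  using rep by (simp add: representing_parameters_def upper_half_plane_def)

lemma integrand_integrable:
  assumes "0 < Im z"
  shows "integrable \<mu> (\<lambda>t. (1 + of_real t * z) / (of_real t - z))"
  by (rule integrable_const_bound[where B = "cmod (1 + z\<^sup>2) / Im z + cmod z"])
    (use nevanlinna_integrand_bound[OF assms] in auto)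

lemma dilation_kernel_measurable [measurable]: "dilation_kernel z \<in> borel_measurable \<mu>"
  unfolding dilation_kernel_def[abs_def] by measurable

lemma right_weight_measurable [measurable]: "right_weight \<in> borel_measurable \<mu>"
  unfolding right_weight_def[abs_def] by measurable

lemma right_weight_integrable_iff:
  "integrable \<mu> right_weight \<longleftrightarrow>
    (\<integral>\<^sup>+ t\<in>{..<0}. ennreal \<bar>t\<bar> \<partial>\<mu>) < \<infinity> \<and> (\<integral>\<^sup>+ t\<in>{0<..}. ennreal (t\<^sup>2) \<partial>\<mu>) < \<infinity>"
proof -
  have "(\<integral>\<^sup>+ t. ennreal (right_weight t) \<partial>\<mu>)
      = (\<integral>\<^sup>+ t. ennreal \<bar>t\<bar> * indicator {..<0} t + ennreal (t\<^sup>2) * indicator {0<..} t \<partial>\<mu>)"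
    by (intro nn_integral_cong) (auto simp: right_weight_def indicator_def)
  also have "\<dots> = (\<integral>\<^sup>+ t\<in>{..<0}. ennreal \<bar>t\<bar> \<partial>\<mu>) + (\<integral>\<^sup>+ t\<in>{0<..}. ennreal (t\<^sup>2) \<partial>\<mu>)"
    by (intro nn_integral_add) measurable
  finally show ?thesis
    by (simp add: integrable_iff_bounded right_weight_nonneg less_top[symmetric])
qed

lemma dilation_kernel_integrable:
  assumes "0 < Im z"
  shows "integrable \<mu> (dilation_kernel z)"
proof -
  have "integrable \<mu> (\<lambda>t. Im ((1 + of_real t * z) / (of_real t - z)) / Im z)"
    using integrand_integrable[OF assms] by auto
  then show ?thesis
    using assms by (simp add: Im_nevanlinna_integrand[OF assms] del: Im_divide)
qed

text \<open>
  The relative increase of $\mathrm{Im}\,z$ under $f$, as \<open>Im_f\<close> shows.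
\<close>
definition dilation :: "complex \<Rightarrow> real" where
  "dilation z = (LINT t|\<mu>. dilation_kernel z t)"

lemma dilation_nonneg: "0 \<le> dilation z"
  unfolding dilation_def by (rule integral_nonneg_AE) (simp add: dilation_kernel_nonneg)

lemma Im_f:
  assumes "0 < Im z"
  shows "Im (f z) = Im z * (1 + dilation z)"
proof -
  have "Im (LINT t|\<mu>. (1 + of_real t * z) / (of_real t - z)) = (LINT t|\<mu>. Im z * dilation_kernel z t)"
    using integrand_integrable[OF assms]
    by (simp add: Im_nevanlinna_integrand[OF assms] integral_Im[symmetric] del: integral_Im)
  then show ?thesis
    by (simp add: f_eq[OF assms] dilation_def algebra_simps)
qed

lemma Im_f_ge: "0 < Im z \<Longrightarrow> Im z \<le> Im (f z)"
  using dilation_nonneg[of z] by (simp add: Im_f)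

text \<open>
  On a pair of points, $f$ deviates from a translation only as much as it stretches the heights of
  the two points: a form of the Schwarz-Pick lemma adapted to products along an orbit.
\<close>
lemma f_diff:
  assumes "0 < Im z" "0 < Im w"
  obtains J where "f w - f z = (w - z) * (1 + J)" "cmod J \<le> (dilation z + dilation w) / 2"
proof
  define J where "J = (LINT t|\<mu>. complex_of_real (1 + t\<^sup>2) / ((of_real t - z) * (of_real t - w)))"
  have "f w - f z = (w - z) + (LINT t|\<mu>. (1 + of_real t * w) / (of_real t - w)
      - (1 + of_real t * z) / (of_real t - z))"
    using assms by (simp add: f_eq integrand_integrable)
  also have "\<dots> = (w - z) * (1 + J)"
    unfolding nevanlinna_integrand_diff[OF assms] J_def
    by (subst integral_mult_right_zero) (simp add: algebra_simps)
  finally show "f w - f z = (w - z) * (1 + J)" .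
  have "cmod J \<le> (LINT t|\<mu>. (dilation_kernel z t + dilation_kernel w t) / 2)"
    unfolding J_def
  proof (rule Bochner_Integration.integral_norm_bound_integral)
    show g: "integrable \<mu> (\<lambda>t. (dilation_kernel z t + dilation_kernel w t) / 2)"
      using assms by (intro integrable_divide Bochner_Integration.integrable_add dilation_kernel_integrable)
    show "integrable \<mu> (\<lambda>t. complex_of_real (1 + t\<^sup>2) / ((of_real t - z) * (of_real t - w)))"
      using mixed_kernel_bound[OF assms]
      by (intro Bochner_Integration.integrable_bound[OF g])
        (auto simp: dilation_kernel_nonneg abs_of_nonneg add_nonneg_nonneg simp del: of_real_add of_real_power)
  qed (rule mixed_kernel_bound[OF assms])
  then show "cmod J \<le> (dilation z + dilation w) / 2"
    using assms by (simp add: dilation_def dilation_kernel_integrable)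
qed

section \<open>Orbits of bounded height\<close>

definition orbit :: "(nat \<Rightarrow> complex) \<Rightarrow> bool" where
  "orbit z \<longleftrightarrow> 0 < Im (z 0) \<and> (\<forall>n. z (Suc n) = f (z n))"

lemma orbit_Suc: "orbit z \<Longrightarrow> z (Suc n) = f (z n)"
  by (simp add: orbit_def)

lemma orbit_Im_ge:
  assumes "orbit z"
  shows "Im (z 0) \<le> Im (z n)"
proof (induction n)
  case (Suc n)
  then show ?case
    using Im_f_ge[of "z n"] assms by (simp add: orbit_def)
qed simp

lemma orbit_Im_pos: "orbit z \<Longrightarrow> 0 < Im (z n)"
  using orbit_Im_ge[of z n] by (simp add: orbit_def)

lemma orbit_step_Im:
  assumes "orbit z"
  shows "Im (z (Suc n)) - Im (z n) = Im (z n) * dilation (z n)"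
  using Im_f[OF orbit_Im_pos[OF assms, of n]] by (simp add: orbit_Suc[OF assms] algebra_simps)

lemma finite_shift_iff_bounded_orbit:
  "finite_shift f \<longleftrightarrow> (\<exists>z Y. orbit z \<and> (\<forall>n. Im (z n) \<le> Y))"
proof
  assume "finite_shift f"
  then obtain w Y where "0 < Im w" "\<And>n. Im ((f ^^ n) w) \<le> Y"
    by (auto simp: finite_shift_def upper_half_plane_def bdd_above_def)
  then show "\<exists>z Y. orbit z \<and> (\<forall>n. Im (z n) \<le> Y)"
    by (intro exI[of _ "\<lambda>n. (f ^^ n) w"] exI[of _ Y]) (simp add: orbit_def)
next
  assume "\<exists>z Y. orbit z \<and> (\<forall>n. Im (z n) \<le> Y)"
  then obtain z Y where z: "orbit z" "\<And>n. Im (z n) \<le> Y" by auto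
  have "(f ^^ n) (z 0) = z n" for n
    by (induction n) (simp_all add: orbit_Suc[OF z(1)])
  moreover have "bdd_above (range (\<lambda>n. Im (z n)))" using z(2) by (rule bdd_aboveI2)
  moreover have "z 0 \<in> upper_half_plane" using z(1) by (simp add: upper_half_plane_def orbit_def)
  ultimately show "finite_shift f"
    unfolding finite_shift_def by (intro bexI[of _ "z 0"]) simp_all
qed

lemma first_moment_integrable:
  assumes "integrable \<mu> right_weight"
  shows "integrable \<mu> (\<lambda>t. t)"
proof (rule Bochner_Integration.integrable_bound)
  show "integrable \<mu> (\<lambda>t. 1 + right_weight t)" using assms by simp
  show "AE t in \<mu>. norm t \<le> norm (1 + right_weight t)"
    using right_weight_ge_abs right_weight_nonneg by (simp add: abs_of_nonneg add_nonneg_nonneg)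
qed simp

text \<open>
  In the right quadrant, at heights bounded below, $(1+t^2)/(t-z)$ is dominated by an
  integrable function, and it tends to $0$ pointwise as $\mathrm{Re}\,z \to \infty$. This identifies the
  asymptotic speed of an orbit that moves to the right, and it also produces a region in which
  orbits must move to the right.
\<close>
lemma displacement_tendsto:
  assumes w: "integrable \<mu> right_weight" and y: "0 < y" "\<And>n. y \<le> Im (z n)"
    and Re: "filterlim (\<lambda>n. Re (z n)) at_top sequentially"
  shows "(\<lambda>n. f (z n) - z n) \<longlonglongrightarrow> of_real (\<beta> - (LINT t|\<mu>. t))"
proof -
  have Im_pos: "0 < Im (z n)" for n using y(1) y(2)[of n] by linarith
  let ?g = "\<lambda>n t. complex_of_real (1 + t\<^sup>2) / (of_real t - z n)"
  have t: "integrable \<mu> (\<lambda>t. t)" by (rule first_moment_integrable[OF w])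
  have split: "f (z n) - z n = of_real (\<beta> - (LINT t|\<mu>. t)) + (LINT t|\<mu>. ?g n t)" for n
  proof -
    have "(LINT t|\<mu>. ?g n t)
        = (LINT t|\<mu>. (1 + of_real t * z n) / (of_real t - z n) + complex_of_real t)"
      by (simp add: nevanlinna_integrand_eq[OF Im_pos])
    also have "\<dots> = (LINT t|\<mu>. (1 + of_real t * z n) / (of_real t - z n))
        + (LINT t|\<mu>. complex_of_real t)"
      using integrand_integrable[OF Im_pos] t by (intro Bochner_Integration.integral_add) auto
    finally show ?thesis by (simp add: f_eq[OF Im_pos])
  qed
  have "(\<lambda>n. LINT t|\<mu>. ?g n t) \<longlonglongrightarrow> (LINT t|\<mu>. 0)"
  proof -
    obtain N where N: "\<And>n. n \<ge> N \<Longrightarrow> 0 \<le> Re (z n)"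
      using filterlim_at_top[THEN iffD1, OF Re, rule_format, of 0]
      by (auto simp: eventually_sequentially)
    have "(\<lambda>n. LINT t|\<mu>. ?g (n + N) t) \<longlonglongrightarrow> (LINT t|\<mu>. 0)"
    proof (rule integral_dominated_convergence)
      show "integrable \<mu> (\<lambda>t. (1 + 1 / y) * (1 + right_weight t))" using w by simp
      show "AE t in \<mu>. norm (?g (n + N) t) \<le> (1 + 1 / y) * (1 + right_weight t)" for n
        using shifted_integrand_bound[OF N y] by simp
      have "(\<lambda>n. ?g n t) \<longlonglongrightarrow> 0" for t
      proof (rule tendsto_divide_0[OF tendsto_const])
        have "filterlim (\<lambda>n. - t + Re (z n)) at_top sequentially"
          by (rule filterlim_tendsto_add_at_top[OF tendsto_const Re])
        then show "filterlim (\<lambda>n. of_real t - z n) at_infinity sequentially"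
        proof (intro filterlim_norm_at_top_imp_at_infinity, elim filterlim_at_top_mono)
          show "\<forall>\<^sub>F n in sequentially. - t + Re (z n) \<le> norm (of_real t - z n)"
          proof (rule always_eventually, rule allI)
            show "- t + Re (z n) \<le> norm (of_real t - z n)" for n
              using abs_Re_le_cmod[of "of_real t - z n"] by simp
          qed
        qed
      qed
      then show "AE t in \<mu>. (\<lambda>n. ?g (n + N) t) \<longlonglongrightarrow> 0"
        by (intro AE_I2 LIMSEQ_ignore_initial_segment)
    qed auto
    then show ?thesis by (rule LIMSEQ_offset)
  qed
  then show ?thesis
    unfolding split using tendsto_add[OF tendsto_const, of _ 0] by fastforce
qed

text \<open>
  The heights increase by $y_n I(z_n) \ge y_0 I(z_n)$ at each step, so bounded height leaves room only
  for a convergent series.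
\<close>
lemma dilation_summable:
  assumes z: "orbit z" and bound: "\<And>n. Im (z n) \<le> Y"
  shows "summable (\<lambda>n. dilation (z n))"
proof (rule summableI_nonneg_bounded[where x = "Y / Im (z 0)"])
  show "0 \<le> dilation (z n)" for n by (rule dilation_nonneg)
  show "(\<Sum>n<m. dilation (z n)) \<le> Y / Im (z 0)" for m
  proof -
    have y: "0 < Im (z 0)" using z by (simp add: orbit_def)
    have "Im (z 0) * (\<Sum>n<m. dilation (z n)) \<le> (\<Sum>n<m. Im (z n) * dilation (z n))"
      unfolding sum_distrib_left
      by (intro sum_mono mult_right_mono orbit_Im_ge z dilation_nonneg)
    also have "\<dots> = Im (z m) - Im (z 0)"
      unfolding orbit_step_Im[OF z, symmetric] by (rule sum_lessThan_telescope)
    also have "\<dots> \<le> Y" using bound[of m] y by simp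
    finally show ?thesis using y by (simp add: field_simps)
  qed
qed

text \<open>
  Successive increments differ by factors $1 + J_n$ with $\sum|J_n| < \infty$; the factors do not vanish
  because the orbit meets no fixed point. An absolutely convergent product of non-zero factors
  has a non-zero value, and this is what excludes an orbit of bounded height whose steps tend
  to zero.
\<close>
lemma increments_limit:
  assumes z: "orbit z" and bound: "\<And>n. Im (z n) \<le> Y"
    and neq: "\<And>n. f (z n) \<noteq> z n"
  obtains l :: real where "l \<noteq> 0" "(\<lambda>n. z (Suc n) - z n) \<longlonglongrightarrow> of_real l"
proof -
  let ?D = "\<lambda>n. z (Suc n) - z n"
  have "\<exists>J. \<forall>n. ?D (Suc n) = ?D n * (1 + J n)
      \<and> cmod (J n) \<le> (dilation (z n) + dilation (z (Suc n))) / 2"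
  proof (intro choice allI)
    show "\<exists>J. ?D (Suc n) = ?D n * (1 + J) \<and> cmod J \<le> (dilation (z n) + dilation (z (Suc n))) / 2" for n
      by (rule f_diff[OF orbit_Im_pos[OF z, of n] orbit_Im_pos[OF z, of "Suc n"]])
        (auto simp: orbit_Suc[OF z])
  qed
  then obtain J where J: "\<And>n. ?D (Suc n) = ?D n * (1 + J n)"
      "\<And>n. cmod (J n) \<le> (dilation (z n) + dilation (z (Suc n))) / 2"
    by metis
  have sm: "summable (\<lambda>n. dilation (z n))" by (rule dilation_summable[OF z bound])
  then have "summable (\<lambda>n. (dilation (z n) + dilation (z (Suc n))) / 2)"
    by (intro summable_divide summable_add) (simp_all add: summable_Suc_iff[of "\<lambda>n. dilation (z n)"])
  then have "summable (\<lambda>n. cmod (J n))"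
    by (rule summable_comparison_test') (use J(2) in auto)
  then have conv: "convergent_prod (\<lambda>n. 1 + J n)"
    by (intro abs_convergent_prod_imp_convergent_prod summable_imp_abs_convergent_prod) simp
  have D0: "?D n \<noteq> 0" for n using neq orbit_Suc[OF z] by simp
  then have factor: "1 + J n \<noteq> 0" for n
    using J(1)[of n] by (metis mult_zero_right)
  have prod: "?D (Suc n) = ?D 0 * (\<Prod>k\<le>n. 1 + J k)" for n
    by (induction n) (simp_all only: J(1) prod.atMost_Suc atMost_0 mult.assoc
        prod.insert finite.emptyI empty_iff not_False_eq_True prod.empty mult_1_right)
  define L where "L = ?D 0 * prodinf (\<lambda>n. 1 + J n)"
  have "(\<lambda>n. ?D (Suc n)) \<longlonglongrightarrow> L"
    unfolding prod L_def by (intro tendsto_mult_left convergent_prod_LIMSEQ conv)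
  then have L: "?D \<longlonglongrightarrow> L" by (rule LIMSEQ_imp_Suc)
  have "L \<noteq> 0" using D0 prodinf_nonzero[OF conv factor] by (simp add: L_def)
  \<comment> \<open>The vertical increments are summands of a convergent series, so only horizontal motion survives.\<close>
  have "Im L = 0"
  proof (rule LIMSEQ_unique)
    show "(\<lambda>n. Im (?D n)) \<longlonglongrightarrow> Im L" by (rule tendsto_Im[OF L])
    show "(\<lambda>n. Im (?D n)) \<longlonglongrightarrow> 0"
    proof (rule tendsto_sandwich)
      show "\<forall>\<^sub>F n in sequentially. 0 \<le> Im (?D n)"
        using orbit_step_Im[OF z] orbit_Im_pos[OF z] dilation_nonneg
        by (intro always_eventually allI) (simp add: less_imp_le)
      show "\<forall>\<^sub>F n in sequentially. Im (?D n) \<le> Y * dilation (z n)"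
        using orbit_step_Im[OF z] bound dilation_nonneg
        by (intro always_eventually allI) (simp add: mult_right_mono)
      show "(\<lambda>n. Y * dilation (z n)) \<longlonglongrightarrow> 0"
        using tendsto_mult_left[OF summable_LIMSEQ_zero[OF sm], of Y] by simp
    qed simp
  qed
  then have "L = of_real (Re L)" by (simp add: complex_eq_iff)
  with L \<open>L \<noteq> 0\<close> show ?thesis by (intro that[of "Re L"]) auto
qed

section \<open>Moments forced by an orbit of bounded height\<close>

text \<open>
  Taken in the extended non-negative reals, so that it can be integrated term by term before
  anything is known about the convergence of the series at individual points $t$.
\<close>
definition accumulated :: "(nat \<Rightarrow> complex) \<Rightarrow> real \<Rightarrow> ennreal" where
  "accumulated z t = (\<Sum>n. ennreal (dilation_kernel (z n) t))"

lemma accumulated_measurable [measurable]: "accumulated z \<in> borel_measurable \<mu>"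
  unfolding accumulated_def[abs_def] by measurable

lemma accumulated_ge_sum: "ennreal (\<Sum>n<m. dilation_kernel (z n) t) \<le> accumulated z t"
proof -
  have "ennreal (\<Sum>n<m. dilation_kernel (z n) t) = (\<Sum>n<m. ennreal (dilation_kernel (z n) t))"
    by (rule sum_ennreal[symmetric]) (rule dilation_kernel_nonneg)
  then show ?thesis
    unfolding accumulated_def by (simp add: sum_le_suminf)
qed

lemma accumulated_ge: "ennreal (dilation_kernel (z n) t) \<le> accumulated z t"
  unfolding accumulated_def using sum_le_suminf[of "\<lambda>n. ennreal (dilation_kernel (z n) t)" "{n}"] by simp

lemma accumulated_finite:
  assumes z: "orbit z" and bound: "\<And>n. Im (z n) \<le> Y"
  shows "(\<integral>\<^sup>+ t. accumulated z t \<partial>\<mu>) < \<infinity>"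
proof -
  have "(\<integral>\<^sup>+ t. accumulated z t \<partial>\<mu>) = (\<Sum>n. \<integral>\<^sup>+ t. ennreal (dilation_kernel (z n) t) \<partial>\<mu>)"
    unfolding accumulated_def by (rule nn_integral_suminf) measurable
  also have "\<dots> = (\<Sum>n. ennreal (dilation (z n)))"
    unfolding dilation_def
    by (intro suminf_cong nn_integral_eq_integral dilation_kernel_integrable orbit_Im_pos z)
      (simp add: dilation_kernel_nonneg)
  also have "\<dots> = ennreal (\<Sum>n. dilation (z n))"
    by (intro suminf_ennreal2 dilation_nonneg dilation_summable[OF z bound])
  finally show ?thesis by simp
qed

lemma finite_if_le_accumulated:
  assumes "orbit z" "\<And>n. Im (z n) \<le> Y" "\<And>t. g t \<le> ennreal K * accumulated z t"
  shows "(\<integral>\<^sup>+ t. g t \<partial>\<mu>) < \<infinity>"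
proof -
  have "(\<integral>\<^sup>+ t. g t \<partial>\<mu>) \<le> ennreal K * (\<integral>\<^sup>+ t. accumulated z t \<partial>\<mu>)"
    using assms(3) by (subst nn_integral_cmult[symmetric]) (auto intro!: nn_integral_mono)
  also have "\<dots> < \<infinity>" using accumulated_finite[OF assms(1,2)] by (simp add: ennreal_mult_less_top)
  finally show ?thesis .
qed

text \<open>
  Bounded steps give $|z_n| \le |z_0| + Cn$. Hence every index $n \le |t|$ has $|t-z_n|$ at most a constant
  multiple of $1+|t|$, which makes its kernel at least a constant, and there are about $|t|$ such
  indices. This covers both half-lines at once, whichever way the orbit moves.
\<close>
lemma abs_le_accumulated:
  assumes z: "orbit z" and incr: "\<And>n. cmod (z (Suc n) - z n) \<le> C"
  obtains K where "0 \<le> K" "\<And>t. ennreal \<bar>t\<bar> \<le> ennreal K * accumulated z t"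
proof
  define A where "A = 1 + C + cmod (z 0)"
  have C: "0 \<le> C" using order_trans[OF norm_ge_zero incr] .
  have A: "0 < A" using C by (simp add: A_def add_pos_nonneg)
  show "0 \<le> 2 * A\<^sup>2" by simp
  fix t :: real
  define m where "m = nat \<lceil>\<bar>t\<bar>\<rceil>"
  have norm_z: "cmod (z n) \<le> cmod (z 0) + C * real n" for n
  proof (induction n)
    case (Suc n)
    have "cmod (z (Suc n)) \<le> cmod (z (Suc n) - z n) + cmod (z n)"
      using norm_triangle_ineq[of "z (Suc n) - z n" "z n"] by simp
    with Suc incr[of n] show ?case by (simp add: algebra_simps)
  qed simp
  have low: "1 / (2 * A\<^sup>2) \<le> dilation_kernel (z n) t" if "n < m" for n
  proof -
    have n: "real n \<le> \<bar>t\<bar>" using that by (simp add: m_def) linarith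
    have "cmod (of_real t - z n) \<le> \<bar>t\<bar> + (cmod (z 0) + C * \<bar>t\<bar>)"
      using norm_triangle_ineq4[of "of_real t" "z n"] norm_z[of n] mult_left_mono[OF n C] by simp
    also have "\<dots> \<le> A * (1 + \<bar>t\<bar>)" using C by (simp add: A_def algebra_simps)
    finally have "1 + t\<^sup>2 \<le> (A * (1 + \<bar>t\<bar>))\<^sup>2 * dilation_kernel (z n) t"
      by (rule dilation_kernel_lower[OF orbit_Im_pos[OF z]])
    also have "\<dots> \<le> (A\<^sup>2 * (2 * (1 + t\<^sup>2))) * dilation_kernel (z n) t"
    proof (rule mult_right_mono[OF _ dilation_kernel_nonneg])
      have "(1 + \<bar>t\<bar>)\<^sup>2 \<le> 2 * (1 + t\<^sup>2)"
        using sum_squares_bound[of "\<bar>t\<bar>" 1] by (simp add: power2_eq_square algebra_simps)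
      then show "(A * (1 + \<bar>t\<bar>))\<^sup>2 \<le> A\<^sup>2 * (2 * (1 + t\<^sup>2))"
        by (simp only: power_mult_distrib) (intro mult_left_mono, auto)
    qed
    also have "\<dots> = (1 + t\<^sup>2) * (2 * A\<^sup>2 * dilation_kernel (z n) t)" by (simp only: ac_simps)
    finally have "(1 + t\<^sup>2) * 1 \<le> (1 + t\<^sup>2) * (2 * A\<^sup>2 * dilation_kernel (z n) t)" by simp
    then have "1 \<le> 2 * A\<^sup>2 * dilation_kernel (z n) t"
      by (subst (asm) mult_le_cancel_left_pos) (simp_all add: add_pos_nonneg)
    then show ?thesis using A by (simp add: field_simps)
  qed
  have "\<bar>t\<bar> \<le> real m" by (simp add: m_def)
  also have "\<dots> = 2 * A\<^sup>2 * (\<Sum>n<m. 1 / (2 * A\<^sup>2))" using A by simp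
  also have "\<dots> \<le> 2 * A\<^sup>2 * (\<Sum>n<m. dilation_kernel (z n) t)"
    using low by (intro mult_left_mono sum_mono) auto
  finally have "ennreal \<bar>t\<bar> \<le> ennreal (2 * A\<^sup>2) * ennreal (\<Sum>n<m. dilation_kernel (z n) t)"
    by (subst ennreal_mult[symmetric]) (auto intro!: sum_nonneg dilation_kernel_nonneg ennreal_leI)
  also have "\<dots> \<le> ennreal (2 * A\<^sup>2) * accumulated z t"
    by (intro mult_left_mono accumulated_ge_sum) simp
  finally show "ennreal \<bar>t\<bar> \<le> ennreal (2 * A\<^sup>2) * accumulated z t" .
qed

text \<open>
  An orbit that moves to the right with bounded steps and bounded height passes every $t \ge 0$ at
  a bounded distance: the first point whose real part reaches $t$ overshoots by at most one step,
  or is the starting point. A single kernel is then already of order $1+t^2$.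
\<close>
lemma square_le_accumulated:
  assumes z: "orbit z" and bound: "\<And>n. Im (z n) \<le> Y"
    and incr: "\<And>n. cmod (z (Suc n) - z n) \<le> C"
    and Re: "filterlim (\<lambda>n. Re (z n)) at_top sequentially"
  obtains K where "0 \<le> K" "\<And>t. 0 \<le> t \<Longrightarrow> ennreal (t\<^sup>2) \<le> ennreal K * accumulated z t"
proof
  define A where "A = \<bar>Re (z 0)\<bar> + C + Y"
  show "0 \<le> A\<^sup>2" by simp
  fix t :: real assume t: "0 \<le> t"
  have C: "0 \<le> C" using order_trans[OF norm_ge_zero incr] .
  have ex: "\<exists>n. t \<le> Re (z n)"
    using filterlim_at_top[THEN iffD1, OF Re, rule_format, of t]
    by (auto simp: eventually_sequentially)
  define n where "n = (LEAST n. t \<le> Re (z n))"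
  have n: "t \<le> Re (z n)" unfolding n_def by (rule LeastI_ex[OF ex])
  have near: "\<bar>t - Re (z n)\<bar> \<le> \<bar>Re (z 0)\<bar> + C"
  proof (cases n)
    case 0
    then show ?thesis using n t C by simp
  next
    case (Suc k)
    then have "\<not> t \<le> Re (z k)" unfolding n_def by (metis lessI not_less_Least)
    moreover have "Re (z n) - Re (z k) \<le> C"
      using abs_Re_le_cmod[of "z n - z k"] incr[of k] by (simp add: Suc)
    ultimately show ?thesis using n by simp
  qed
  have "cmod (of_real t - z n) \<le> \<bar>t - Re (z n)\<bar> + \<bar>Im (z n)\<bar>"
    using cmod_le[of "of_real t - z n"] by simp
  also have "\<dots> \<le> A"
    using near bound[of n] orbit_Im_pos[OF z, of n] by (simp add: A_def)
  finally have "1 + t\<^sup>2 \<le> A\<^sup>2 * dilation_kernel (z n) t"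
    by (rule dilation_kernel_lower[OF orbit_Im_pos[OF z]])
  then have "ennreal (t\<^sup>2) \<le> ennreal (A\<^sup>2) * ennreal (dilation_kernel (z n) t)"
    by (subst ennreal_mult[symmetric]) (auto intro!: dilation_kernel_nonneg ennreal_leI)
  also have "\<dots> \<le> ennreal (A\<^sup>2) * accumulated z t"
    by (intro mult_left_mono accumulated_ge) simp
  finally show "ennreal (t\<^sup>2) \<le> ennreal (A\<^sup>2) * accumulated z t" .
qed

text \<open>
  The orbit's speed is computed twice, as the given limit $l$ and by dominated convergence; the
  latter requires the moments, which therefore have to be obtained first.
\<close>
lemma right_drift_conditions:
  assumes z: "orbit z" and bound: "\<And>n. Im (z n) \<le> Y"
    and l: "(\<lambda>n. z (Suc n) - z n) \<longlonglongrightarrow> of_real l" "0 < l"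
  shows "integrable \<mu> right_weight" "(LINT t|\<mu>. t) < \<beta>"
proof -
  obtain C where C: "\<And>n. cmod (z (Suc n) - z n) \<le> C"
    using convergent_imp_Bseq[OF convergentI[OF l(1)]] by (auto simp: Bseq_def)
  have Re: "filterlim (\<lambda>n. Re (z n)) at_top sequentially"
    using tendsto_Re[OF l(1)] l(2) by (intro at_top_if_increments_tendsto_pos[of _ l]) auto
  obtain K where K: "0 \<le> K" "\<And>t. ennreal \<bar>t\<bar> \<le> ennreal K * accumulated z t"
    using abs_le_accumulated[OF z C] by metis
  obtain L where L: "0 \<le> L" "\<And>t. 0 \<le> t \<Longrightarrow> ennreal (t\<^sup>2) \<le> ennreal L * accumulated z t"
    using square_le_accumulated[OF z bound C Re] by metis
  have "ennreal (right_weight t) \<le> ennreal (max K L) * accumulated z t" for t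
  proof (cases "t < 0")
    case True
    have "ennreal \<bar>t\<bar> \<le> ennreal (max K L) * accumulated z t"
      by (rule order_trans[OF K(2)]) (intro mult_right_mono ennreal_leI, auto)
    with True show ?thesis by (simp add: right_weight_def)
  next
    case False
    have "ennreal (t\<^sup>2) \<le> ennreal (max K L) * accumulated z t"
      by (rule order_trans[OF L(2)]) (use False in \<open>auto intro!: mult_right_mono ennreal_leI\<close>)
    with False show ?thesis by (simp add: right_weight_def)
  qed
  then have "(\<integral>\<^sup>+ t. ennreal (right_weight t) \<partial>\<mu>) < \<infinity>"
    by (rule finite_if_le_accumulated[OF z bound])
  then show w: "integrable \<mu> right_weight"
    by (simp add: integrable_iff_bounded right_weight_nonneg)
  have "(\<lambda>n. f (z n) - z n) \<longlonglongrightarrow> of_real (\<beta> - (LINT t|\<mu>. t))"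
    using z by (intro displacement_tendsto[OF w _ orbit_Im_ge[OF z] Re]) (simp add: orbit_def)
  with l(1) have "complex_of_real l = of_real (\<beta> - (LINT t|\<mu>. t))"
    unfolding orbit_Suc[OF z] by (rule LIMSEQ_unique)
  then show "(LINT t|\<mu>. t) < \<beta>" using l(2) unfolding of_real_eq_iff by simp
qed

section \<open>Orbits of bounded height from the moment conditions\<close>

text \<open>
  For $t < 0$ the starting point lies at distance at least $|t|$ to the right of $t$, and the tail
  decay in \<open>separated_sum\<close> turns $1+t^2$ into $1+|t|$. For $t \ge 0$ the orbit may pass over $t$, and
  only the uniform bound is available.
\<close>
lemma sum_dilation_kernel_bound:
  assumes d: "0 < d" and sep: "\<And>n. Re (z n) + d \<le> Re (z (Suc n))"
    and z: "\<And>n. 1 \<le> Im (z n)" "0 \<le> Re (z 0)"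
  shows "(\<Sum>n<m. dilation_kernel (z n) t) \<le> 4 * (1 + d) / d * (1 + right_weight t)"
proof -
  define a where "a = Re (z 0) - t"
  define K where "K = 2 * (1 + d) / d"
  have K: "0 \<le> K" using d by (simp add: K_def)
  have "(\<Sum>n<m. dilation_kernel (z n) t) \<le> (\<Sum>n<m. (1 + t\<^sup>2) * (1 / (1 + (Re (z n) - t)\<^sup>2)))"
    by (intro sum_mono dilation_kernel_upper z)
  also have "\<dots> = (1 + t\<^sup>2) * (\<Sum>n<m. 1 / (1 + (Re (z n) - t)\<^sup>2))"
    by (rule sum_distrib_left[symmetric])
  also have "\<dots> \<le> (1 + t\<^sup>2) * (K * (1 - a / (1 + \<bar>a\<bar>)))"
    unfolding a_def K_def using sep by (intro mult_left_mono separated_sum[OF d]) auto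
  also have "\<dots> = K * ((1 + t\<^sup>2) * (1 - a / (1 + \<bar>a\<bar>)))" by (simp only: ac_simps)
  also have "\<dots> \<le> K * (2 * (1 + right_weight t))"
  proof (intro mult_left_mono K)
    show "(1 + t\<^sup>2) * (1 - a / (1 + \<bar>a\<bar>)) \<le> 2 * (1 + right_weight t)"
    proof (cases "t < 0")
      case True
      then have a: "\<bar>t\<bar> \<le> a" using z(2) by (simp add: a_def)
      then have "1 - a / (1 + \<bar>a\<bar>) = 1 / (1 + a)" by (simp add: field_simps)
      also have "\<dots> \<le> 1 / (1 + \<bar>t\<bar>)" using a by (intro frac_le) auto
      finally have "(1 + t\<^sup>2) * (1 - a / (1 + \<bar>a\<bar>)) \<le> (1 + t\<^sup>2) * (1 / (1 + \<bar>t\<bar>))"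
        by (intro mult_left_mono) auto
      also have "\<dots> \<le> 1 + \<bar>t\<bar>" using True by (simp add: field_simps power2_eq_square)
      also have "\<dots> \<le> 2 * (1 + right_weight t)" using True by (simp add: right_weight_def)
      finally show ?thesis .
    next
      case False
      have "- a \<le> 1 + \<bar>a\<bar>" by linarith
      then have "- a / (1 + \<bar>a\<bar>) \<le> 1" by (subst pos_divide_le_eq) auto
      then have "(1 + t\<^sup>2) * (1 - a / (1 + \<bar>a\<bar>)) \<le> (1 + t\<^sup>2) * 2"
        by (intro mult_left_mono) simp_all
      then show ?thesis using False by (simp add: right_weight_def)
    qed
  qed
  also have "\<dots> = 4 * (1 + d) / d * (1 + right_weight t)"
    using d by (simp add: K_def field_simps)
  finally show ?thesis .
qed

text \<open>
  An orbit started far enough to the right keeps moving right by at least half of the limiting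
  speed $\beta - \int t\,d\mu$, so its real parts are separated and the logarithms of its heights are
  bounded by an integral that the moment conditions make finite.
\<close>
lemma bounded_orbit_if_right_conditions:
  assumes w: "integrable \<mu> right_weight" and drift: "(LINT t|\<mu>. t) < \<beta>"
  shows "\<exists>z Y. orbit z \<and> (\<forall>n. Im (z n) \<le> Y)"
proof -
  define d where "d = (\<beta> - (LINT t|\<mu>. t)) / 2"
  have d: "0 < d" using drift by (simp add: d_def)
  \<comment> \<open>Otherwise a sequence of bad points with real parts tending to infinity would contradict
    the limit of the displacement, which is $2d$.\<close>
  obtain X :: nat where X: "\<And>w. real X \<le> Re w \<Longrightarrow> 1 \<le> Im w \<Longrightarrow> d \<le> Re (f w - w)"
  proof (rule ccontr)
    assume "\<not> thesis"
    then have "\<forall>n::nat. \<exists>w. real n \<le> Re w \<and> 1 \<le> Im w \<and> Re (f w - w) < d"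
      using that by (meson not_le)
    then obtain w where w': "\<And>n. real n \<le> Re (w n)" "\<And>n. 1 \<le> Im (w n)"
        "\<And>n. Re (f (w n) - w n) < d"
      by metis
    have "filterlim (\<lambda>n. Re (w n)) at_top sequentially"
      by (rule filterlim_at_top_mono[OF filterlim_real_sequentially])
        (use w'(1) in \<open>auto intro: always_eventually\<close>)
    from tendsto_Re[OF displacement_tendsto[OF w zero_less_one w'(2) this]]
    have "(\<lambda>n. Re (f (w n) - w n)) \<longlonglongrightarrow> \<beta> - (LINT t|\<mu>. t)"
      by (simp only: Re_complex_of_real)
    then have "\<forall>\<^sub>F n in sequentially. d < Re (f (w n) - w n)"
      by (rule order_tendstoD(1)) (use drift in \<open>simp add: d_def\<close>)
    then show False using w'(3) by (auto simp: eventually_sequentially not_less[symmetric] dest: less_asym)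
  qed
  define z where "z n = (f ^^ n) (Complex (real X) 1)" for n
  have z: "orbit z" by (simp add: orbit_def z_def)
  have Im: "1 \<le> Im (z n)" for n using orbit_Im_ge[OF z, of n] by (simp add: z_def)
  have Re: "real X \<le> Re (z n)" for n
  proof (induction n)
    case (Suc n)
    then show ?case using X[OF Suc Im] d by (simp add: orbit_Suc[OF z])
  qed (simp add: z_def)
  have sep: "Re (z n) + d \<le> Re (z (Suc n))" for n
    using X[OF Re Im, of n] by (simp add: orbit_Suc[OF z])
  define S where "S = (LINT t|\<mu>. 4 * (1 + d) / d * (1 + right_weight t))"
  have S: "(\<Sum>n<m. dilation (z n)) \<le> S" for m
  proof -
    have int: "integrable \<mu> (dilation_kernel (z n))" for n
      by (rule dilation_kernel_integrable[OF orbit_Im_pos[OF z]])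
    have "(\<Sum>n<m. dilation (z n)) = (LINT t|\<mu>. (\<Sum>n<m. dilation_kernel (z n) t))"
      unfolding dilation_def by (rule Bochner_Integration.integral_sum[symmetric]) (rule int)
    also have "\<dots> \<le> S"
      unfolding S_def using w Re[of 0]
      by (intro integral_mono Bochner_Integration.integrable_sum int
            sum_dilation_kernel_bound[where z = z, OF d sep Im]) auto
    finally show ?thesis .
  qed
  have "Im (z m) \<le> exp (\<Sum>n<m. dilation (z n))" for m
  proof (induction m)
    case (Suc m)
    have "Im (z (Suc m)) = Im (z m) * (1 + dilation (z m))"
      using Im_f[OF orbit_Im_pos[OF z]] by (simp add: orbit_Suc[OF z])
    also have "\<dots> \<le> exp (\<Sum>n<m. dilation (z n)) * exp (dilation (z m))"
      using Suc dilation_nonneg[of "z m"] exp_ge_add_one_self[of "dilation (z m)"]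
      by (intro mult_mono) auto
    finally show ?case by (simp add: exp_add)
  qed (simp add: z_def)
  then have "Im (z m) \<le> exp S" for m
    using S[of m] by (meson exp_le_cancel_iff order_trans)
  with z show ?thesis by blast
qed

end

section \<open>Reflection in the imaginary axis\<close>

definition reflect :: "complex \<Rightarrow> complex" where
  "reflect z = - cnj z"

lemma reflect_simps [simp]:
  "Re (reflect z) = - Re z" "Im (reflect z) = Im z" "reflect (reflect z) = z"
  by (simp_all add: reflect_def)

context nevanlinna_map
begin

text \<open>
  Substituting $-t$ for $t$ turns the integrand at $z$ into minus the conjugate of the integrand at
  $-\bar z$.
\<close>
lemma reflected_nevanlinna_map:
  "nevanlinna_map (reflect \<circ> f \<circ> reflect) (- \<beta>) (distr \<mu> borel uminus)"
proof
  have fin: "finite_measure (distr \<mu> borel uminus)" by (rule finite_measure_distr) measurable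
  have "emeasure (distr \<mu> borel uminus) UNIV = emeasure \<mu> UNIV"
    by (subst emeasure_distr) (auto simp: space_mu)
  then have null: "- \<beta> \<noteq> 0 \<or> emeasure (distr \<mu> borel uminus) UNIV \<noteq> 0"
    using rep by (simp add: representing_parameters_def)
  have "(reflect \<circ> f \<circ> reflect) z = z + of_real (- \<beta>)
      + (LINT t|distr \<mu> borel uminus. (1 + of_real t * z) / (of_real t - z))" if "0 < Im z" for z
  proof -
    have "(LINT t|distr \<mu> borel uminus. (1 + of_real t * z) / (of_real t - z))
        = (LINT t|\<mu>. (1 + of_real (- t) * z) / (of_real (- t) - z))"
      by (rule integral_distr) measurable
    also have "\<dots> = (LINT t|\<mu>. - cnj ((1 + of_real t * reflect z) / (of_real t - reflect z)))"
      by (intro Bochner_Integration.integral_cong)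
        (simp_all add: reflect_def minus_divide_right del: divide_minus_right)
    also have "\<dots> = reflect (LINT t|\<mu>. (1 + of_real t * reflect z) / (of_real t - reflect z))"
      by (simp add: reflect_def del: complex_cnj_divide complex_cnj_add complex_cnj_mult complex_cnj_diff)
    finally show ?thesis
      using that by (simp add: f_eq) (simp add: reflect_def)
  qed
  with fin null show "representing_parameters (reflect \<circ> f \<circ> reflect) (- \<beta>) (distr \<mu> borel uminus)"
    by (simp add: representing_parameters_def upper_half_plane_def)
qed

lemma reflected_orbit_iff:
  "nevanlinna_map.orbit (reflect \<circ> f \<circ> reflect) z \<longleftrightarrow> orbit (reflect \<circ> z)"
  by (auto simp: nevanlinna_map.orbit_def[OF reflected_nevanlinna_map] orbit_def)
    (metis reflect_simps(3))+

lemma reflected_mean: "(LINT t|distr \<mu> borel uminus. t) = - (LINT t|\<mu>. t)"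
  by (subst integral_distr) auto

lemma reflected_right_weight_integrable_iff:
  "integrable (distr \<mu> borel uminus) right_weight \<longleftrightarrow>
    (\<integral>\<^sup>+ t\<in>{..<0}. ennreal (t\<^sup>2) \<partial>\<mu>) < \<infinity> \<and> (\<integral>\<^sup>+ t\<in>{0<..}. ennreal \<bar>t\<bar> \<partial>\<mu>) < \<infinity>"
proof -
  have "(\<integral>\<^sup>+ t\<in>{..<0}. ennreal \<bar>t\<bar> \<partial>distr \<mu> borel uminus) = (\<integral>\<^sup>+ t\<in>{0<..}. ennreal \<bar>t\<bar> \<partial>\<mu>)"
    by (subst nn_integral_distr) (auto intro!: nn_integral_cong simp: indicator_def)
  moreover have "(\<integral>\<^sup>+ t\<in>{0<..}. ennreal (t\<^sup>2) \<partial>distr \<mu> borel uminus) = (\<integral>\<^sup>+ t\<in>{..<0}. ennreal (t\<^sup>2) \<partial>\<mu>)"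
    by (subst nn_integral_distr) (auto intro!: nn_integral_cong simp: indicator_def)
  ultimately show ?thesis
    unfolding nevanlinna_map.right_weight_integrable_iff[OF reflected_nevanlinna_map] by auto
qed

end

section \<open>Characterisation of finite shift\<close>

theorem theorem1p5:
  fixes f :: "complex \<Rightarrow> complex" and \<beta> :: real and \<mu> :: "real measure"
  assumes "parabolic_infinity f"
    and "representing_parameters f \<beta> \<mu>"
  shows "(finite_shift f \<longrightarrow> (\<integral>\<^sup>+ t. ennreal \<bar>t\<bar> \<partial>\<mu>) < \<infinity>) \<and>
    (finite_shift f \<longleftrightarrow>
      ((\<integral>\<^sup>+ t\<in>{..<0}. ennreal \<bar>t\<bar> \<partial>\<mu>) < \<infinity> \<and>
       (\<integral>\<^sup>+ t\<in>{0<..}. ennreal (t\<^sup>2) \<partial>\<mu>) < \<infinity> \<and>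
       \<beta> > (LINT t|\<mu>. t)) \<or>
      ((\<integral>\<^sup>+ t\<in>{..<0}. ennreal (t\<^sup>2) \<partial>\<mu>) < \<infinity> \<and>
       (\<integral>\<^sup>+ t\<in>{0<..}. ennreal \<bar>t\<bar> \<partial>\<mu>) < \<infinity> \<and>
       \<beta> < (LINT t|\<mu>. t)))"
proof -
  interpret nevanlinna_map f \<beta> \<mu> by unfold_locales (rule assms(2))
  interpret R: nevanlinna_map "reflect \<circ> f \<circ> reflect" "- \<beta>" "distr \<mu> borel uminus"
    by (rule reflected_nevanlinna_map)
  have neq: "f z \<noteq> z" if "0 < Im z" for z
    using assms(1) that by (simp add: parabolic_infinity_def non_elliptic_def upper_half_plane_def)
  have moment: "(\<integral>\<^sup>+ t. ennreal \<bar>t\<bar> \<partial>\<mu>) < \<infinity>"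
    and side: "(integrable \<mu> right_weight \<and> (LINT t|\<mu>. t) < \<beta>) \<or>
      (integrable (distr \<mu> borel uminus) right_weight \<and> \<beta> < (LINT t|\<mu>. t))"
    if shift: "finite_shift f"
  proof -
    obtain z Y where z: "orbit z" and Y: "\<And>n. Im (z n) \<le> Y"
      using shift finite_shift_iff_bounded_orbit by auto
    obtain l where l: "l \<noteq> 0" "(\<lambda>n. z (Suc n) - z n) \<longlonglongrightarrow> of_real l"
      using increments_limit[OF z Y neq[OF orbit_Im_pos[OF z]]] by metis
    obtain C where C: "\<And>n. cmod (z (Suc n) - z n) \<le> C"
      using convergent_imp_Bseq[OF convergentI[OF l(2)]] by (auto simp: Bseq_def)
    obtain K where "\<And>t. ennreal \<bar>t\<bar> \<le> ennreal K * accumulated z t"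
      using abs_le_accumulated[OF z C] by metis
    then show "(\<integral>\<^sup>+ t. ennreal \<bar>t\<bar> \<partial>\<mu>) < \<infinity>" by (rule finite_if_le_accumulated[OF z Y])
    show "(integrable \<mu> right_weight \<and> (LINT t|\<mu>. t) < \<beta>) \<or>
      (integrable (distr \<mu> borel uminus) right_weight \<and> \<beta> < (LINT t|\<mu>. t))"
    proof (cases "0 < l")
      case True
      then show ?thesis using right_drift_conditions[OF z Y l(2)] by blast
    next
      case False
      have "R.orbit (reflect \<circ> z)"
        unfolding reflected_orbit_iff using z by (simp add: o_def)
      moreover have "(\<lambda>n. (reflect \<circ> z) (Suc n) - (reflect \<circ> z) n) \<longlonglongrightarrow> of_real (- l)"
        using tendsto_minus[OF tendsto_cnj[OF l(2)]] by (simp add: reflect_def)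
      ultimately show ?thesis
        using R.right_drift_conditions[of "reflect \<circ> z" Y "- l"] Y l(1) False
        by (auto simp: reflected_mean)
    qed
  qed
  have right: "finite_shift f" if "integrable \<mu> right_weight" "(LINT t|\<mu>. t) < \<beta>"
    using bounded_orbit_if_right_conditions[OF that] finite_shift_iff_bounded_orbit by blast
  have left: "finite_shift f"
    if w: "integrable (distr \<mu> borel uminus) right_weight" and drift: "\<beta> < (LINT t|\<mu>. t)"
  proof -
    have mean: "(LINT t|distr \<mu> borel uminus. t) < - \<beta>" using drift by (simp add: reflected_mean)
    obtain z Y where "R.orbit z" "\<And>n. Im (z n) \<le> Y"
      using R.bounded_orbit_if_right_conditions[OF w mean] by blast
    then have "orbit (reflect \<circ> z)" "\<And>n. Im ((reflect \<circ> z) n) \<le> Y"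
      by (simp_all add: reflected_orbit_iff)
    then show ?thesis using finite_shift_iff_bounded_orbit by blast
  qed
  show ?thesis
    using moment side right left
    unfolding right_weight_integrable_iff reflected_right_weight_integrable_iff by blast
qed

end
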